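(* For every positive integer $n$, $\mathsf{DP(n)} = \mathsf{F(n)}$, and the set of extreme points of this polytope is exactly $TP(n)$.
   Context: All graphs are simple. For a graph on vertex set $[n]=\{1,\dots,n\}$ with degrees $d_1,\dots,d_n$, its degree partition is $(d_1,\dots,d_n)$ rearranged in weakly decreasing order (zero entries allowed). $\mathsf{DP(n)}\subseteq\mathbb{R}^n$ is the convex hull of all degree partitions of simple graphs on $[n]$. A simple graph is threshold if every induced subgraph has a dominating vertex (adjacent to all other vertices of the subgraph) or an isolated vertex. $TP(n)$ is the set of degree partitions of threshold graphs on $[n]$ (threshold partitions). $\mathsf{F(n)}$ is the set of $x\in\mathbb{R}^n$ satisfying $x_1\ge x_2\ge\cdots\ge x_n$ and $\sum_{i=1}^k x_i-\sum_{i=n-l+1}^n x_i\le k(n-1-l)$ for all integers $k,l\ge 0$ with $1\le k+l\le n$. *)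

theory Defs
  imports "HOL-Analysis.Analysis" "Graph_Theory.Graph_Theory"
begin

text \<open>
  The space of vectors of length n is \<open>real ^ 'n\<close> for a finite linearly ordered index type
  with n = \<open>CARD('n)\<close> elements; the linear order identifies \<open>'n\<close> with {1, ..., n}.
  Every positive n arises, e.g. from the numeral types.  Vertices, on the other hand, are the
  natural numbers 1, ..., n themselves.
\<close>

text \<open>The 1-based position of an index: the coordinate \<open>x $ j\<close> is the entry number \<open>pos j\<close>.\<close>
definition pos :: "'n::{finite,linorder} \<Rightarrow> nat" where
  "pos j = card {i. i \<le> j}"

text \<open>
  In \<open>Graph_Theory\<close> a simple graph is a finite loop-free digraph without parallel arcs whose arc
  relation is symmetric, i.e. an edge uv is represented by the two arcs (u,v) and (v,u).
  Hence the degree of a vertex is its out-degree.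
\<close>
definition simple_graph_on :: "nat \<Rightarrow> nat pair_pre_digraph \<Rightarrow> bool" where
  "simple_graph_on n G \<longleftrightarrow> pair_graph G \<and> pverts G = {1..n}"

definition degree_partition :: "nat \<Rightarrow> nat pair_pre_digraph \<Rightarrow> nat list" where
  "degree_partition n G = rev (sort (map (out_degree (with_proj G)) [1..<Suc n]))"

definition degree_partition_vec :: "nat pair_pre_digraph \<Rightarrow> real ^ 'n::{finite,linorder}" where
  "degree_partition_vec G = (\<chi> j. real (degree_partition CARD('n) G ! (pos j - 1)))"

definition dominating_vertex :: "('a, 'b) pre_digraph \<Rightarrow> 'a \<Rightarrow> bool" where
  "dominating_vertex H v \<longleftrightarrow> v \<in> verts H \<and> (\<forall>w \<in> verts H - {v}. v \<rightarrow>\<^bsub>H\<^esub> w)"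

definition isolated_vertex :: "('a, 'b) pre_digraph \<Rightarrow> 'a \<Rightarrow> bool" where
  "isolated_vertex H v \<longleftrightarrow> v \<in> verts H \<and> (\<forall>w \<in> verts H. \<not> v \<rightarrow>\<^bsub>H\<^esub> w)"

text \<open>Induced subgraphs are taken on nonempty vertex sets; otherwise no graph would be threshold.\<close>
definition threshold_graph :: "'a pair_pre_digraph \<Rightarrow> bool" where
  "threshold_graph G \<longleftrightarrow> pair_graph G \<and>
     (\<forall>S. S \<subseteq> pverts G \<and> S \<noteq> {} \<longrightarrow>
        (\<exists>v. dominating_vertex (with_proj G \<restriction> S) v \<or> isolated_vertex (with_proj G \<restriction> S) v))"

definition DP :: "(real ^ 'n::{finite,linorder}) set" where
  "DP = convex hull {degree_partition_vec G | G. simple_graph_on CARD('n) G}"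

definition TP :: "(real ^ 'n::{finite,linorder}) set" where
  "TP = {degree_partition_vec G | G. simple_graph_on CARD('n) G \<and> threshold_graph G}"

definition F_set :: "(real ^ 'n::{finite,linorder}) set" where
  "F_set = {x. (\<forall>i j. i \<le> j \<longrightarrow> x $ i \<ge> x $ j) \<and>
           (\<forall>k l :: nat. 1 \<le> k + l \<and> k + l \<le> CARD('n) \<longrightarrow>
              (\<Sum>j | pos j \<in> {1..k}. x $ j)
                - (\<Sum>j | pos j \<in> {CARD('n) - l + 1..CARD('n)}. x $ j)
              \<le> real k * (real CARD('n) - 1 - real l))}"

end

theory Submission
  imports Defs
begin

text \<open>
  The facet system of \<open>F_set\<close> is stable under adding and removing a dominating vertex (first entry
  n - 1) or an isolated one (last entry 0).  Both operations preserve and reflect extremality, because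
  n - 1 and 0 are the extreme values a coordinate can take on \<open>F_set\<close>.  So the point is
  that an extreme point has first entry n - 1 or last entry 0.  Otherwise consider the pairs (k, l)
  whose constraint is tight.  Uncrossing, i.e. submodularity of the right-hand side k (n - 1 - l)
  in (k, l), yields a least nonzero tight pair, and from it a direction along which all tight
  constraints stay tight, contradicting extremality.  Hence the extreme points of \<open>F_set\<close> are the threshold partitions, and
  the theorem of Krein, Milman and Minkowski gives the equality with \<open>DP\<close>.
\<close>

section \<open>Feasible and threshold sequences\<close>

definition end_diff :: "nat \<Rightarrow> (nat \<Rightarrow> real) \<Rightarrow> nat \<Rightarrow> nat \<Rightarrow> real" where
  "end_diff n x k l = (\<Sum>i<k. x i) - (\<Sum>i=n-l..<n. x i)"

text \<open>The slack of the facet inequality for the pair (k, l). Positions count from 0 and values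
  at \<open>n\<close> and beyond are irrelevant, so peeling an entry is a shift or a
  truncation.\<close>

definition gap :: "nat \<Rightarrow> (nat \<Rightarrow> real) \<Rightarrow> nat \<Rightarrow> nat \<Rightarrow> real" where
  "gap n x k l = real k * (real n - 1 - real l) - end_diff n x k l"

definition feasible :: "nat \<Rightarrow> (nat \<Rightarrow> real) \<Rightarrow> bool" where
  "feasible n x \<longleftrightarrow> (\<forall>i. Suc i < n \<longrightarrow> x (Suc i) \<le> x i) \<and>
     (\<forall>k l. k + l \<le> n \<longrightarrow> 0 \<le> gap n x k l)"

text \<open>The recursion mirrors building a threshold graph one vertex at a time: a dominating
  vertex has the largest degree and raises all others by 1, an isolated one appends a 0.\<close>

fun threshold_seq :: "nat \<Rightarrow> (nat \<Rightarrow> real) \<Rightarrow> bool" where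
  "threshold_seq 0 x \<longleftrightarrow> True"
| "threshold_seq (Suc n) x \<longleftrightarrow>
     x 0 = real n \<and> threshold_seq n (\<lambda>i. x (Suc i) - 1) \<or> x n = 0 \<and> threshold_seq n x"

lemma feasibleI:
  assumes "\<And>i. Suc i < n \<Longrightarrow> x (Suc i) \<le> x i" "\<And>k l. k + l \<le> n \<Longrightarrow> 0 \<le> gap n x k l"
  shows "feasible n x"
  using assms by (auto simp: feasible_def)

lemma feasible_Suc_le: "feasible n x \<Longrightarrow> Suc i < n \<Longrightarrow> x (Suc i) \<le> x i"
  by (auto simp: feasible_def)

lemma feasible_gap: "feasible n x \<Longrightarrow> k + l \<le> n \<Longrightarrow> 0 \<le> gap n x k l"
  by (auto simp: feasible_def)

lemma feasible_antimono:
  assumes "feasible n x" "i \<le> j" "j < n"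
  shows "x j \<le> x i"
  using assms(2,3)
proof (induction rule: dec_induct)
  case (step j)
  then show ?case using feasible_Suc_le[OF assms(1), of j] by simp
qed simp

lemma gap_Suc_left: "gap n x (Suc k) l = gap n x k l + (real n - 1 - real l) - x k"
  by (simp add: gap_def end_diff_def algebra_simps)

lemma gap_Suc_right:
  assumes "l < n"
  shows "gap n x k (Suc l) = gap n x k l - real k + x (n - Suc l)"
proof -
  have "{n - Suc l..<n} = insert (n - Suc l) {n - l..<n}" using assms by auto
  then show ?thesis using assms by (simp add: gap_def end_diff_def algebra_simps)
qed

lemma gap_0_0 [simp]: "gap n x 0 0 = 0"
  by (simp add: gap_def end_diff_def)

lemma feasible_nonneg:
  assumes "feasible n x" "i < n"
  shows "0 \<le> x i"
proof -
  have "0 \<le> x (n - 1)"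
    using feasible_gap[OF assms(1), of 0 1] assms(2) by (simp add: gap_Suc_right)
  moreover have "x (n - 1) \<le> x i"
    using feasible_antimono[OF assms(1)] assms(2) by auto
  ultimately show ?thesis by simp
qed

lemma feasible_le:
  assumes "feasible n x" "i < n"
  shows "x i \<le> real n - 1"
proof -
  have "x 0 \<le> real n - 1"
    using feasible_gap[OF assms(1), of 1 0] assms(2) by (simp add: gap_Suc_left)
  then show ?thesis
    using feasible_antimono[OF assms(1), of 0 i] assms(2) by simp
qed

text \<open>The new first entry adds n to the head sum, and undoing the shift by 1 adds k - l to the
  difference. The bound grows by the same amount: (k + 1) (n - l) = k (n - 1 - l) + n + k -
  l.\<close>

lemma gap_dominating:
  assumes "x 0 = real n" "l \<le> n"
  shows "gap (Suc n) x (Suc k) l = gap n (\<lambda>i. x (Suc i) - 1) k l"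
proof -
  have "(\<Sum>i<Suc k. x i) = real n + (\<Sum>i<k. x (Suc i))"
    using assms(1) by (simp add: sum.lessThan_Suc_shift del: sum.lessThan_Suc)
  moreover have "(\<Sum>i=Suc n - l..<Suc n. x i) = (\<Sum>i=n-l..<n. x (Suc i))"
    using assms(2) by (simp add: Suc_diff_le sum.shift_bounds_Suc_ivl del: sum.op_ivl_Suc)
  ultimately show ?thesis
    using assms(2) by (simp add: gap_def end_diff_def sum_subtractf algebra_simps)
qed

lemma gap_isolated:
  assumes "x n = 0" "l \<le> n"
  shows "gap (Suc n) x k (Suc l) = gap n x k l"
  using assms by (simp add: gap_def end_diff_def algebra_simps)

text \<open>Constraints with a nonempty head correspond one to one by \<open>gap_dominating\<close>;
  those with an empty head only ask for nonnegative tail sums.\<close>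

lemma feasible_dominating:
  assumes "x 0 = real n"
  shows "feasible (Suc n) x \<longleftrightarrow> feasible n (\<lambda>i. x (Suc i) - 1)"
proof
  assume x: "feasible (Suc n) x"
  show "feasible n (\<lambda>i. x (Suc i) - 1)"
  proof (rule feasibleI)
    fix k l assume "k + l \<le> n"
    then show "0 \<le> gap n (\<lambda>i. x (Suc i) - 1) k l"
      using gap_dominating[of x, OF assms, of l k] feasible_gap[OF x, of "Suc k" l] by simp
  qed (use feasible_Suc_le[OF x] in simp)
next
  assume y: "feasible n (\<lambda>i. x (Suc i) - 1)"
  show "feasible (Suc n) x"
  proof (rule feasibleI)
    fix i assume "Suc i < Suc n"
    then show "x (Suc i) \<le> x i"
      using feasible_le[OF y, of 0] feasible_Suc_le[OF y, of "i - 1"] assms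
      by (cases i) auto
  next
    fix k l assume kl: "k + l \<le> Suc n"
    show "0 \<le> gap (Suc n) x k l"
    proof (cases k)
      case 0
      \<comment> \<open>With an empty head the slack is the tail sum itself, so nonnegative entries
        suffice.\<close>
      have "0 \<le> x i" if "i < Suc n" for i
        using feasible_nonneg[OF y, of "i - 1"] that assms by (cases i) auto
      then show ?thesis using 0 by (auto simp: gap_def end_diff_def intro!: sum_nonneg simp del: sum.op_ivl_Suc)
    next
      case (Suc j)
      then show ?thesis using gap_dominating[of x, OF assms, of l j] feasible_gap[OF y, of j l] kl by simp
    qed
  qed
qed

text \<open>Dual to the dominating case: constraints with a nonempty tail correspond, and those with
  an empty tail follow from the bound n on every entry.\<close>

lemma feasible_isolated:
  assumes "x n = 0"
  shows "feasible (Suc n) x \<longleftrightarrow> feasible n x"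
proof
  assume x: "feasible (Suc n) x"
  show "feasible n x"
  proof (rule feasibleI)
    fix k l assume "k + l \<le> n"
    then show "0 \<le> gap n x k l"
      using gap_isolated[of x, OF assms, of l k] feasible_gap[OF x, of k "Suc l"] by simp
  qed (use feasible_Suc_le[OF x] in simp)
next
  assume y: "feasible n x"
  show "feasible (Suc n) x"
  proof (rule feasibleI)
    fix i assume "Suc i < Suc n"
    then show "x (Suc i) \<le> x i"
      using feasible_nonneg[OF y, of i] feasible_Suc_le[OF y, of i] assms
      by (cases "Suc i = n") auto
  next
    fix k l assume kl: "k + l \<le> Suc n"
    show "0 \<le> gap (Suc n) x k l"
    proof (cases l)
      case 0
      have "x i \<le> real n" if "i < Suc n" for i
        using feasible_le[OF y, of i] that assms by (cases "i = n") auto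
      then have "(\<Sum>i<k. x i) \<le> (\<Sum>i<k. real n)"
        using kl by (intro sum_mono) auto
      then show ?thesis using 0 by (simp add: gap_def end_diff_def)
    next
      case (Suc j)
      then show ?thesis using gap_isolated[of x, OF assms, of j k] feasible_gap[OF y, of k j] kl by simp
    qed
  qed
qed

lemma threshold_seq_feasible: "threshold_seq n x \<Longrightarrow> feasible n x"
proof (induction n arbitrary: x)
  case 0
  then show ?case by (simp add: feasible_def)
next
  case (Suc n)
  then show ?case using feasible_dominating feasible_isolated by auto
qed

section \<open>Threshold sequences are extreme\<close>

lemma convex_combination_eq:
  fixes a b c u :: real
  assumes "c = (1 - u) * a + u * b" "0 < u" "u < 1" "a \<le> c \<and> b \<le> c \<or> c \<le> a \<and> c \<le> b"
  shows "a = c" "b = c"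
proof -
  have "(1 - u) * (c - a) + u * (c - b) = 0" using assms(1) by (simp add: algebra_simps)
  \<comment> \<open>The two weighted differences have the same sign, so their vanishing sum makes
    each of them vanish.\<close>
  moreover have "(1 - u) * (c - a) \<ge> 0 \<and> u * (c - b) \<ge> 0 \<or> (1 - u) * (c - a) \<le> 0 \<and> u * (c - b) \<le> 0"
    using assms(2-4) by (auto simp: mult_le_0_iff zero_le_mult_iff)
  ultimately have "(1 - u) * (c - a) = 0" "u * (c - b) = 0" by linarith+
  then show "a = c" "b = c" using assms(2,3) by auto
qed

text \<open>The entry to be peeled is n or 0, an extreme value on the feasible set, so both
  endpoints \<open>a\<close> and \<open>b\<close> share it. They therefore stay feasible after
  peeling, and induction settles the other entries.\<close>

lemma threshold_seq_extreme:
  assumes "threshold_seq n x" "feasible n a" "feasible n b" "0 < u" "u < 1"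
    and "\<And>i. i < n \<Longrightarrow> x i = (1 - u) * a i + u * b i" "i < n"
  shows "a i = x i \<and> b i = x i"
  using assms
proof (induction n arbitrary: x a b i)
  case 0
  then show ?case by simp
next
  case (Suc n)
  show ?case
  proof (cases "x 0 = real n \<and> threshold_seq n (\<lambda>i. x (Suc i) - 1)")
    case True
    have "a 0 \<le> x 0" "b 0 \<le> x 0"
      using feasible_le[OF Suc.prems(2), of 0] feasible_le[OF Suc.prems(3), of 0] True by auto
    then have ab: "a 0 = x 0" "b 0 = x 0"
      using convex_combination_eq[OF Suc.prems(6)[of 0] Suc.prems(4,5)] by auto
    show ?thesis
    proof (cases i)
      case 0
      then show ?thesis using ab by simp
    next
      case (Suc j)
      have "a (Suc j) - 1 = x (Suc j) - 1 \<and> b (Suc j) - 1 = x (Suc j) - 1"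
      proof (rule Suc.IH[of "\<lambda>i. x (Suc i) - 1" "\<lambda>i. a (Suc i) - 1" "\<lambda>i. b (Suc i) - 1"])
        show "feasible n (\<lambda>i. a (Suc i) - 1)" "feasible n (\<lambda>i. b (Suc i) - 1)"
          using feasible_dominating[of a n] feasible_dominating[of b n] ab True Suc.prems by auto
      qed (use True Suc.prems Suc in \<open>auto simp: algebra_simps\<close>)
      then show ?thesis using Suc by simp
    qed
  next
    case False
    then have x: "x n = 0" "threshold_seq n x" using Suc.prems(1) by auto
    have "x n \<le> a n" "x n \<le> b n"
      using feasible_nonneg[OF Suc.prems(2), of n] feasible_nonneg[OF Suc.prems(3), of n] x by auto
    then have ab: "a n = x n" "b n = x n"
      using convex_combination_eq[OF Suc.prems(6)[of n] Suc.prems(4,5)] by auto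
    show ?thesis
    proof (cases "i = n")
      case True
      then show ?thesis using ab by simp
    next
      case False
      show ?thesis
      proof (rule Suc.IH[of x a b])
        show "feasible n a" "feasible n b"
          using feasible_isolated[of a n] feasible_isolated[of b n] ab x Suc.prems by auto
      qed (use False x Suc.prems in auto)
    qed
  qed
qed

section \<open>Uncrossing and perturbing tight constraints\<close>

text \<open>\<open>end_diff\<close> is modular in (k, l), while the bound k (n - 1 - l) contributes
  (k - k') (l' - l) \<ge> 0 to the slacks of the given pairs minus those of the two exchanged pairs.
  The exchanged slacks are nonnegative and sum to at most 0.\<close>

lemma gap_uncross:
  assumes x: "feasible n x" and kl: "k + l \<le> n" "k' + l' \<le> n" "k' \<le> k" "l \<le> l'"
    and gaps: "gap n x k l = 0" "gap n x k' l' = 0"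
  shows "gap n x k' l = 0"
proof -
  have ge: "0 \<le> gap n x k' l" using feasible_gap[OF x, of k' l] kl by simp
  have ed: "end_diff n x k l + end_diff n x k' l' = end_diff n x k' l + end_diff n x k l'"
    by (simp add: end_diff_def)
  show ?thesis
  proof (cases "k + l' \<le> n")
    case True
    have "(real k - real k') * (real l' - real l) \<ge> 0" using kl by simp
    then have "gap n x k' l + gap n x k l' \<le> gap n x k l + gap n x k' l'"
      using ed by (simp add: gap_def algebra_simps)
    then show ?thesis using gaps ge feasible_gap[OF x True] by simp
  next
    case False
    \<comment> \<open>The positions in both ends of (k, l') cancel, which leaves the pair (n - l', n - k).\<close>
    have A: "(\<Sum>i<k. x i) = (\<Sum>i<n-l'. x i) + (\<Sum>i=n-l'..<k. x i)"
      using False unfolding lessThan_atLeast0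
      by (intro sum.atLeastLessThan_concat[symmetric]) auto
    have B: "(\<Sum>i=n-l'..<n. x i) = (\<Sum>i=n-l'..<k. x i) + (\<Sum>i=k..<n. x i)"
      using False kl by (intro sum.atLeastLessThan_concat[symmetric]) auto
    have e2: "end_diff n x k l' = end_diff n x (n - l') (n - k)"
      using A B kl by (simp add: end_diff_def)
    \<comment> \<open>\<open>t\<close> is the overlap of the two ends. Passing from (k, l') to (n -
      l', n - k) raises the bound by \<open>t\<close>, so the surplus \<open>p * q\<close> drops to
      \<open>p * q - t\<close>. It remains nonnegative, since \<open>t\<close> is at most
      \<open>p\<close> and 1 is at most \<open>q\<close>.\<close>
    define p q t where "p = real k - real k'" and "q = real l' - real l" and "t = real k + real l' - real n"
    have t: "1 \<le> t" "t \<le> p" "t \<le> q" using False kl by (auto simp: p_def q_def t_def)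
    have "t * 1 \<le> p * q" using t by (intro mult_mono) auto
    then have le: "0 \<le> p * q - t" by simp
    have "gap n x k l + gap n x k' l' - gap n x k' l - gap n x (n - l') (n - k) = p * q - t"
      using ed e2 kl by (simp add: gap_def of_nat_diff p_def q_def t_def algebra_simps)
    moreover have "0 \<le> gap n x (n - l') (n - k)" using feasible_gap[OF x] False by simp
    ultimately show ?thesis using gaps ge le by simp
  qed
qed

lemma slack_eventually:
  fixes s c :: real
  assumes "0 \<le> s" "s = 0 \<Longrightarrow> c = 0"
  shows "\<forall>\<^sub>F e in at_right 0. e * \<bar>c\<bar> \<le> s"
proof (cases "c = 0")
  case False
  then have "0 < s / \<bar>c\<bar>" using assms by force
  then have "\<forall>\<^sub>F e in at_right 0. e \<in> {0<..<s / \<bar>c\<bar>}"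
    using eventually_at_right_real by blast
  then show ?thesis
    by (rule eventually_mono) (use False in \<open>auto simp: field_simps\<close>)
qed (use assms in simp)

lemma end_diff_add_scaled:
  "end_diff n (\<lambda>i. x i + e * d i) k l = end_diff n x k l + e * end_diff n d k l"
  by (simp add: end_diff_def sum.distrib sum_distrib_left algebra_simps)

text \<open>Tight constraints do not move along \<open>d\<close>, and the finitely many others have
  positive slack. A small enough step thus keeps all of them, in both directions.\<close>

lemma feasible_perturb:
  assumes x: "feasible n x"
    and blocks: "\<And>i. Suc i < n \<Longrightarrow> x (Suc i) = x i \<Longrightarrow> d (Suc i) = d i"
    and tight: "\<And>k l. k + l \<le> n \<Longrightarrow> gap n x k l = 0 \<Longrightarrow> end_diff n d k l = 0"
  shows "\<exists>e>0. feasible n (\<lambda>i. x i + e * d i) \<and> feasible n (\<lambda>i. x i - e * d i)"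
proof -
  define K where "K = {p. fst p + snd p \<le> n}"
  have "K \<subseteq> {..n} \<times> {..n}" by (auto simp: K_def)
  then have fin: "finite K" by (rule finite_subset) simp
  have "\<forall>\<^sub>F e in at_right 0. \<forall>i\<in>{i. Suc i < n}. e * \<bar>d (Suc i) - d i\<bar> \<le> x i - x (Suc i)"
    by (intro eventually_ball_finite ballI slack_eventually)
       (use feasible_Suc_le[OF x] blocks in \<open>auto intro: finite_subset[of _ "{..n}"]\<close>)
  moreover have "\<forall>\<^sub>F e in at_right 0. \<forall>p\<in>K. e * \<bar>end_diff n d (fst p) (snd p)\<bar> \<le> gap n x (fst p) (snd p)"
    by (intro eventually_ball_finite ballI slack_eventually fin)
       (use feasible_gap[OF x] tight in \<open>auto simp: K_def\<close>)
  moreover have "\<forall>\<^sub>F e in at_right (0::real). 0 < e"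
    by (simp add: eventually_at_right_less)
  ultimately have "\<forall>\<^sub>F e in at_right 0. 0 < e \<and> (\<forall>i\<in>{i. Suc i < n}. e * \<bar>d (Suc i) - d i\<bar> \<le> x i - x (Suc i))
      \<and> (\<forall>p\<in>K. e * \<bar>end_diff n d (fst p) (snd p)\<bar> \<le> gap n x (fst p) (snd p))"
    by eventually_elim auto
  then obtain e where "0 < e \<and> (\<forall>i\<in>{i. Suc i < n}. e * \<bar>d (Suc i) - d i\<bar> \<le> x i - x (Suc i))
      \<and> (\<forall>p\<in>K. e * \<bar>end_diff n d (fst p) (snd p)\<bar> \<le> gap n x (fst p) (snd p))"
    using eventually_happens'[OF trivial_limit_at_right_real] by blast
  then have e: "0 < e"
      "\<And>i. Suc i < n \<Longrightarrow> e * \<bar>d (Suc i) - d i\<bar> \<le> x i - x (Suc i)"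
      "\<And>k l. k + l \<le> n \<Longrightarrow> e * \<bar>end_diff n d k l\<bar> \<le> gap n x k l"
    by (auto simp: K_def)
  \<comment> \<open>Treats both signs at once, \<open>s\<close> being \<open>e\<close> or
    \<open>-e\<close>.\<close>
  have "feasible n (\<lambda>i. x i + s * d i)" if s: "\<bar>s\<bar> = e" for s
  proof (rule feasibleI)
    fix i assume i: "Suc i < n"
    have "s * (d (Suc i) - d i) \<le> \<bar>s * (d (Suc i) - d i)\<bar>" by simp
    also have "\<dots> \<le> x i - x (Suc i)" using e(2)[OF i] s by (simp add: abs_mult)
    finally show "x (Suc i) + s * d (Suc i) \<le> x i + s * d i" by (simp add: algebra_simps)
  next
    fix k l assume kl: "k + l \<le> n"
    have "s * end_diff n d k l \<le> \<bar>s * end_diff n d k l\<bar>" by simp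
    also have "\<dots> \<le> gap n x k l" using e(3)[OF kl] s by (simp add: abs_mult)
    finally show "0 \<le> gap n (\<lambda>i. x i + s * d i) k l" by (simp add: gap_def end_diff_add_scaled)
  qed
  from this[of e] this[of "-e"] show ?thesis using e(1) by (intro exI[of _ e]) auto
qed

section \<open>Extreme feasible sequences\<close>

lemma feasible_cong:
  assumes "\<And>i. i < n \<Longrightarrow> x i = y i"
  shows "feasible n x \<longleftrightarrow> feasible n y"
proof -
  have "gap n x k l = gap n y k l" if "k + l \<le> n" for k l
    using assms that by (auto simp: gap_def end_diff_def intro!: sum.cong arg_cong2[of _ _ _ _ "(-)"])
  then show ?thesis using assms by (auto simp: feasible_def)
qed

lemma threshold_seq_cong:
  assumes "\<And>i. i < n \<Longrightarrow> x i = y i"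
  shows "threshold_seq n x \<longleftrightarrow> threshold_seq n y"
  using assms
proof (induction n arbitrary: x y)
  case (Suc n)
  have "threshold_seq n (\<lambda>i. x (Suc i) - 1) = threshold_seq n (\<lambda>i. y (Suc i) - 1)"
    "threshold_seq n x = threshold_seq n y"
    using Suc.prems by (auto intro!: Suc.IH)
  then show ?case using Suc.prems by simp
qed simp

section \<open>The least tight pair and a direction respecting all tight pairs\<close>

lemma gap_left_pos:
  assumes "feasible n x" "x 0 < real n - 1" "0 < k" "k \<le> n"
  shows "0 < gap n x k 0"
proof -
  have "(\<Sum>i<k. x i) < (\<Sum>i<k. real n - 1)"
  proof (rule sum_strict_mono)
    fix i assume "i \<in> {..<k}"
    then show "x i < real n - 1"
      using feasible_antimono[OF assms(1), of 0 i] assms(2,4) by auto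
  qed (use assms in auto)
  then show ?thesis by (simp add: gap_def end_diff_def)
qed

lemma gap_right_pos:
  assumes "feasible n x" "0 < x (n - 1)" "0 < l" "l \<le> n"
  shows "0 < gap n x 0 l"
proof -
  have "(\<Sum>i=n-l..<n. 0) < (\<Sum>i=n-l..<n. x i)"
  proof (rule sum_strict_mono)
    fix i assume "i \<in> {n-l..<n}"
    then have "x (n - 1) \<le> x i" using feasible_antimono[OF assms(1)] by auto
    then show "0 < x i" using assms(2) by simp
  qed (use assms in auto)
  then show ?thesis by (simp add: gap_def end_diff_def)
qed

text \<open>Both end sums equal k l: the larger ends contain the supports of size k and l, and k' +
  l' \<le> n keeps each end away from the opposite support.\<close>

lemma end_diff_balanced:
  assumes "k \<le> k'" "l \<le> l'" "k' + l' \<le> n"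
  shows "end_diff n (\<lambda>i. if i < k then real l else if n - l \<le> i then real k else 0) k' l' = 0"
proof -
  let ?d = "\<lambda>i. if i < k then real l else if n - l \<le> i then real k else 0"
  have "(\<Sum>i<k'. ?d i) = (\<Sum>i<k. real l)"
    using assms by (intro sum.mono_neutral_cong_right) auto
  moreover have "(\<Sum>i=n-l'..<n. ?d i) = (\<Sum>i=n-l..<n. real k)"
    using assms by (intro sum.mono_neutral_cong_right) auto
  ultimately show ?thesis using assms by (simp add: end_diff_def)
qed

text \<open>Take a tight nonzero pair with least k + l. If another one were smaller in some
  component, uncrossing would make the componentwise minimum tight, with a smaller sum. That minimum
  is nonzero because the strict end bounds force both components of every tight pair to be
  positive.\<close>

lemma exists_minimal_tight:
  assumes x: "feasible n x" and ends: "x 0 < real n - 1" "0 < x (n - 1)"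
    and ex: "\<exists>k l. 0 < k + l \<and> k + l \<le> n \<and> gap n x k l = 0"
  obtains k l where "0 < k" "0 < l" "k + l \<le> n" "gap n x k l = 0"
    "\<And>k' l'. 0 < k' + l' \<Longrightarrow> k' + l' \<le> n \<Longrightarrow> gap n x k' l' = 0 \<Longrightarrow> k \<le> k' \<and> l \<le> l'"
proof -
  define tight where "tight k l \<longleftrightarrow> 0 < k + l \<and> k + l \<le> n \<and> gap n x k l = 0" for k l
  have pos: "0 < k \<and> 0 < l" if "tight k l" for k l
    using that gap_left_pos[OF x ends(1), of k] gap_right_pos[OF x ends(2), of l]
    by (cases "k = 0"; cases "l = 0") (auto simp: tight_def)
  obtain p where p: "tight (fst p) (snd p)"
    and min: "\<And>q. tight (fst q) (snd q) \<Longrightarrow> fst p + snd p \<le> fst q + snd q"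
    using ex ex_has_least_nat[of "\<lambda>p. tight (fst p) (snd p)" _ "\<lambda>p. fst p + snd p"]
    by (metis fst_conv snd_conv tight_def)
  define k l where "k = fst p" and "l = snd p"
  have kl: "tight k l" using p by (simp add: k_def l_def)
  have min: "k + l \<le> k' + l'" if "tight k' l'" for k' l'
    using min[of "(k', l')"] that by (simp add: k_def l_def)
  have "k \<le> k' \<and> l \<le> l'" if t: "tight k' l'" for k' l'
  proof (rule ccontr)
    assume "\<not> (k \<le> k' \<and> l \<le> l')"
    then consider "k' < k" "l < l'" | "k < k'" "l' < l" using min[OF t] by linarith
    then show False
    proof cases
      case 1
      then have "tight k' l"
        using gap_uncross[OF x, of k l k' l'] kl t pos[OF kl] by (simp add: tight_def)
      then show False using min[of k' l] 1 by simp
    next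
      case 2
      then have "tight k l'"
        using gap_uncross[OF x, of k' l' k l] kl t pos[OF kl] by (simp add: tight_def)
      then show False using min[of k l'] 2 by simp
    qed
  qed
  then show ?thesis using that[of k l] kl pos[OF kl] by (simp add: tight_def)
qed

text \<open>
  With (k, l) the least tight pair, the direction equal to l on the first k and to k on the last l
  coordinates respects all tight constraints.  It breaks a block of equal entries only if
  k + l = n and the block straddles position k; then (k, l) is the only nonzero tight pair,
  and a combination of the all-ones vector and the indicator of the top block does the job.
\<close>
lemma exists_perturbation:
  assumes x: "feasible n x" and ends: "x 0 < real n - 1" "0 < x (n - 1)"
  obtains d j where "j < n" "d j \<noteq> 0"
    "\<And>i. Suc i < n \<Longrightarrow> x (Suc i) = x i \<Longrightarrow> d (Suc i) = d i"
    "\<And>k l. k + l \<le> n \<Longrightarrow> gap n x k l = 0 \<Longrightarrow> end_diff n d k l = 0"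
proof (cases "\<exists>k l. 0 < k + l \<and> k + l \<le> n \<and> gap n x k l = 0")
  case False
  \<comment> \<open>Only (0, 0) is tight, so any nonzero constant direction works.\<close>
  have "0 < n" using ends by (cases n) auto
  moreover have "end_diff n (\<lambda>i. 1) k l = 0" if "k + l \<le> n" "gap n x k l = 0" for k l
    using False that by (cases "k + l = 0") (auto simp: end_diff_def)
  ultimately show ?thesis using that[of 0 "\<lambda>i. 1"] by auto
next
  case True
  obtain k l where kl: "0 < k" "0 < l" "k + l \<le> n" "gap n x k l = 0"
    and min: "\<And>k' l'. 0 < k' + l' \<Longrightarrow> k' + l' \<le> n \<Longrightarrow> gap n x k' l' = 0 \<Longrightarrow> k \<le> k' \<and> l \<le> l'"
    using exists_minimal_tight[OF x ends True] by metis
  \<comment> \<open>By minimality the pairs (k - 1, l) and (k, l - 1) are not tight. Comparing their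
    slacks with that of (k, l) bounds the single entry in which the sums differ.\<close>
  have "gap n x (k - 1) l \<noteq> 0" using min[of "k - 1" l] kl by force
  then have "0 < gap n x (k - 1) l" using feasible_gap[OF x, of "k - 1" l] kl by force
  then have left: "real n - 1 - real l < x (k - 1)"
    using gap_Suc_left[of n x "k - 1" l] kl by simp
  have "gap n x k (l - 1) \<noteq> 0" using min[of k "l - 1"] kl by force
  then have "0 < gap n x k (l - 1)" using feasible_gap[OF x, of k "l - 1"] kl by force
  moreover have "l - 1 < n" using kl by simp
  ultimately have right: "x (n - l) < real k"
    using gap_Suc_right[of "l - 1" n x k] kl by simp
  show ?thesis
  proof (cases "x k < x (k - 1) \<and> x (n - l) < x (n - l - 1)")
    case True
    let ?d = "\<lambda>i. if i < k then real l else if n - l \<le> i then real k else 0"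
    show ?thesis
    proof (rule that[of 0 ?d])
      fix i assume i: "Suc i < n" "x (Suc i) = x i"
      \<comment> \<open>The direction changes value only on entering position k or n - l, and there
        \<open>x\<close> drops strictly.\<close>
      then have "k \<noteq> Suc i" "n - l \<noteq> Suc i"
        using True by (metis diff_Suc_1 less_irrefl)+
      then show "?d (Suc i) = ?d i" by auto
    next
      fix k' l' assume k': "k' + l' \<le> n" "gap n x k' l' = 0"
      show "end_diff n ?d k' l' = 0"
      proof (cases "k' + l' = 0")
        case False
        then show ?thesis using min[of k' l'] k' by (intro end_diff_balanced) auto
      qed (simp add: end_diff_def)
    qed (use kl in auto)
  next
    case False
    \<comment> \<open>Otherwise (k + 1, l) and (k, l + 1) are admissible, and their constraints
      together with \<open>left\<close> and \<open>right\<close> make \<open>x\<close> drop strictly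
      at both places.\<close>
    have n: "n = k + l"
    proof (rule ccontr)
      assume "n \<noteq> k + l"
      then have "0 \<le> gap n x (Suc k) l" "0 \<le> gap n x k (Suc l)"
        using feasible_gap[OF x] kl by auto
      then have "x k \<le> real n - 1 - real l" "real k \<le> x (n - Suc l)"
        using gap_Suc_left[of n x k l] gap_Suc_right[of l n x k] kl \<open>n \<noteq> k + l\<close> by auto
      then show False using False left right by auto
    qed
    then have xk: "x k = x (k - 1)"
      using False feasible_Suc_le[OF x, of "k - 1"] kl by auto
    \<comment> \<open>A nonzero tight pair dominates (k, l) in both components and has sum at most n
      = k + l.\<close>
    have tight: "(k', l') = (0, 0) \<or> (k', l') = (k, l)"
      if "k' + l' \<le> n" "gap n x k' l' = 0" for k' l'
      using min[of k' l'] that n by (cases "k' + l' = 0") auto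
    show ?thesis
    proof (cases "k = l")
      case True
      have "end_diff n (\<lambda>i. 1) k' l' = 0" if "k' + l' \<le> n" "gap n x k' l' = 0" for k' l'
        using tight[OF that] True n by (auto simp: end_diff_def)
      then show ?thesis using that[of 0 "\<lambda>i. 1"] kl by simp
    next
      case False
      \<comment> \<open>For a constant value c, tightness reads (k - l) c = k (k - 1), while
        \<open>left\<close> and \<open>right\<close> give k - 1 < c < k. Comparing signs for k < l,
        and sizes for k > l, excludes this.\<close>
      have "\<exists>j<n. x j \<noteq> x 0"
      proof (rule ccontr)
        assume "\<not> (\<exists>j<n. x j \<noteq> x 0)"
        moreover have "k < n" using kl n by simp
        ultimately have c: "x i = x k" if "i < n" for i using that by metis
        have "(\<Sum>i<k. x i) = (\<Sum>i<k. x k)" "(\<Sum>i=n-l..<n. x i) = (\<Sum>i=n-l..<n. x k)"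
          by (rule sum.cong[OF refl c], simp add: n)+
        then have "end_diff n x k l = (real k - real l) * x k"
          using n by (simp add: end_diff_def algebra_simps)
        then have eq: "(real k - real l) * x k = real k * (real k - 1)"
          using kl(4) n by (simp add: gap_def)
        have bounds: "real k - 1 < x k" "x k < real k" using left right xk n by auto
        show False
        proof (cases "k < l")
          case True
          then have "(real k - real l) * x k < 0"
            using bounds kl(1) by (intro mult_neg_pos) auto
          moreover have "0 \<le> real k * (real k - 1)" using kl(1) by simp
          ultimately show False using eq by simp
        next
          case False
          then have "1 \<le> real k - real l" using \<open>k \<noteq> l\<close> by auto
          then have "(real k - real l) * x k < (real k - real l) * real k"
            using bounds by (intro mult_strict_left_mono) auto
          also have "\<dots> \<le> (real k - 1) * real k" using kl by (intro mult_right_mono) auto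
          finally show False using eq by (simp add: mult.commute)
        qed
      qed
      then obtain j where j: "j < n" "x j \<noteq> x 0" by blast
      \<comment> \<open>\<open>a\<close> marks the top block of equal entries. The all-ones vector
        has end difference k - l and \<open>a\<close> has \<open>w\<close>, so the weights - w and k
        - l cancel; \<open>d\<close> differs at 0 and \<open>j\<close> because k \<noteq> l.\<close>
      define a where "a i = (if x i = x 0 then 1 else 0 :: real)" for i
      define w where "w = end_diff n a k l"
      define d where "d i = - w + (real k - real l) * a i" for i
      have "d 0 \<noteq> d j" using False j by (simp add: d_def a_def)
      then obtain j' where j': "j' < n" "d j' \<noteq> 0"
        using j by (metis gr_zeroI not_less_zero)
      have "end_diff n d k l = 0"
        using end_diff_add_scaled[of n "\<lambda>i. - w" "real k - real l" a k l] n
        by (simp add: d_def w_def end_diff_def algebra_simps)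
      then have "end_diff n d k' l' = 0" if "k' + l' \<le> n" "gap n x k' l' = 0" for k' l'
        using tight[OF that] by (auto simp: end_diff_def)
      then show ?thesis by (intro that[of j' d] j') (auto simp: d_def a_def)
    qed
  qed
qed

text \<open>Extremality is phrased as the absence of a nonzero two-sided perturbation, which is
  inherited by the peeled sequence. If neither end can be peeled, \<open>exists_perturbation\<close>
  contradicts it.\<close>

lemma rigid_threshold_seq:
  assumes "feasible n x"
    and "\<And>d i. feasible n (\<lambda>i. x i + d i) \<Longrightarrow> feasible n (\<lambda>i. x i - d i) \<Longrightarrow> i < n \<Longrightarrow> d i = 0"
  shows "threshold_seq n x"
  using assms
proof (induction n arbitrary: x)
  case 0
  then show ?case by simp
next
  case (Suc n)
  consider "x 0 = real n" | "x n = 0" | "x 0 < real n" "0 < x n"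
    using feasible_le[OF Suc.prems(1), of 0] feasible_nonneg[OF Suc.prems(1), of n] by force
  then show ?case
  proof cases
    case 1
    have "threshold_seq n (\<lambda>i. x (Suc i) - 1)"
    proof (rule Suc.IH)
      show "feasible n (\<lambda>i. x (Suc i) - 1)" using feasible_dominating[of x n] 1 Suc.prems by simp
    next
      fix d i
      assume d: "feasible n (\<lambda>i. x (Suc i) - 1 + d i)" "feasible n (\<lambda>i. x (Suc i) - 1 - d i)" and i: "i < n"
      \<comment> \<open>The perturbation is extended by 0 at the peeled entry, which must keep its
        value n.\<close>
      define d' where "d' = case_nat 0 d"
      have "feasible (Suc n) (\<lambda>i. x i + d' i)" "feasible (Suc n) (\<lambda>i. x i - d' i)"
        using feasible_dominating[of "\<lambda>i. x i + d' i" n] feasible_dominating[of "\<lambda>i. x i - d' i" n] d 1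
        by (simp_all add: d'_def algebra_simps)
      then show "d i = 0" using Suc.prems(2)[of d' "Suc i"] i by (simp add: d'_def)
    qed
    then show ?thesis using 1 by simp
  next
    case 2
    have "threshold_seq n x"
    proof (rule Suc.IH)
      show "feasible n x" using feasible_isolated[of x n] 2 Suc.prems by simp
    next
      fix d i
      assume d: "feasible n (\<lambda>i. x i + d i)" "feasible n (\<lambda>i. x i - d i)" and i: "i < n"
      \<comment> \<open>The value of \<open>d\<close> at \<open>n\<close> is arbitrary and is reset
        so that the last entry stays 0.\<close>
      define d' where "d' = d(n := 0)"
      have "feasible n (\<lambda>i. x i + d' i)" "feasible n (\<lambda>i. x i - d' i)"
        using d feasible_cong[of n "\<lambda>i. x i + d' i" "\<lambda>i. x i + d i"]
          feasible_cong[of n "\<lambda>i. x i - d' i" "\<lambda>i. x i - d i"] by (auto simp: d'_def)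
      then have "feasible (Suc n) (\<lambda>i. x i + d' i)" "feasible (Suc n) (\<lambda>i. x i - d' i)"
        using feasible_isolated[of "\<lambda>i. x i + d' i" n] feasible_isolated[of "\<lambda>i. x i - d' i" n] 2
        by (simp_all add: d'_def)
      then show "d i = 0" using Suc.prems(2)[of d' i] i by (simp add: d'_def)
    qed
    then show ?thesis using 2 by simp
  next
    case 3
    then have ends: "x 0 < real (Suc n) - 1" "0 < x (Suc n - 1)" by auto
    obtain d j where d: "j < Suc n" "d j \<noteq> 0"
      "\<And>i. Suc i < Suc n \<Longrightarrow> x (Suc i) = x i \<Longrightarrow> d (Suc i) = d i"
      "\<And>k l. k + l \<le> Suc n \<Longrightarrow> gap (Suc n) x k l = 0 \<Longrightarrow> end_diff (Suc n) d k l = 0"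
      by (rule exists_perturbation[OF Suc.prems(1) ends]) (rule that)
    obtain e where "0 < e" "feasible (Suc n) (\<lambda>i. x i + e * d i)" "feasible (Suc n) (\<lambda>i. x i - e * d i)"
      using feasible_perturb[OF Suc.prems(1) d(3,4)] by blast
    then show ?thesis using Suc.prems(2)[of "\<lambda>i. e * d i" j] d(1,2) by simp
  qed
qed

section \<open>Degree sequences\<close>

text \<open>Stated for a relation on a set, so that it can be carried along relabellings of the
  vertices.\<close>

definition threshold_on :: "'a set \<Rightarrow> ('a \<Rightarrow> 'a \<Rightarrow> bool) \<Rightarrow> bool" where
  "threshold_on A R \<longleftrightarrow> (\<forall>S\<subseteq>A. S \<noteq> {} \<longrightarrow>
     (\<exists>v\<in>S. (\<forall>w\<in>S - {v}. R v w) \<or> (\<forall>w\<in>S. \<not> R v w)))"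

definition deg :: "nat \<Rightarrow> (nat \<Rightarrow> nat \<Rightarrow> bool) \<Rightarrow> nat \<Rightarrow> nat" where
  "deg n R i = card {j. j < n \<and> R i j}"

lemma threshold_onD:
  assumes "threshold_on A R" "S \<subseteq> A" "S \<noteq> {}"
  obtains v where "v \<in> S" "\<forall>w\<in>S - {v}. R v w" | v where "v \<in> S" "\<forall>w\<in>S. \<not> R v w"
  using assms unfolding threshold_on_def by metis

lemma threshold_on_subset: "threshold_on A R \<Longrightarrow> B \<subseteq> A \<Longrightarrow> threshold_on B R"
  unfolding threshold_on_def by (meson order_trans)

lemma threshold_on_inj_image:
  assumes "inj_on f A" "threshold_on (f ` A) R"
  shows "threshold_on A (\<lambda>i j. R (f i) (f j))"
  unfolding threshold_on_def
proof (intro allI impI)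
  fix S assume S: "S \<subseteq> A" "S \<noteq> {}"
  have inj: "f w \<noteq> f v" if "v \<in> S" "w \<in> S" "w \<noteq> v" for v w
    using inj_onD[OF assms(1)] S that by blast
  from threshold_onD[OF assms(2), of "f ` S"] S
  obtain y where "y \<in> f ` S" "(\<forall>w\<in>f ` S - {y}. R y w) \<or> (\<forall>w\<in>f ` S. \<not> R y w)"
    by (metis image_is_empty image_mono)
  then obtain v where "v \<in> S" "(\<forall>w\<in>f ` S - {f v}. R (f v) w) \<or> (\<forall>w\<in>f ` S. \<not> R (f v) w)"
    by blast
  then show "\<exists>v\<in>S. (\<forall>w\<in>S - {v}. R (f v) (f w)) \<or> (\<forall>w\<in>S. \<not> R (f v) (f w))"
    using inj by (intro bexI[of _ v]) auto
qed

lemma deg_sum: "real (deg n R i) = (\<Sum>j<n. of_bool (R i j))"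
proof -
  have "{j. j < n \<and> R i j} = {..<n} \<inter> {j. R i j}" by auto
  then show ?thesis by (simp add: deg_def sum_of_bool_eq)
qed

text \<open>Count the neighbours of the first k vertices. Each has at most n - l - 1 among the first
  n - l vertices; the adjacencies to the last l vertices are, by symmetry, counted in the degrees of
  those.\<close>

lemma deg_feasible:
  assumes "symp R" "irreflp R" and dec: "\<And>i. Suc i < n \<Longrightarrow> deg n R (Suc i) \<le> deg n R i"
  shows "feasible n (\<lambda>i. real (deg n R i))"
proof (rule feasibleI)
  fix k l assume kl: "k + l \<le> n"
  let ?e = "\<lambda>i j. of_bool (R i j) :: real"
  have split: "real (deg n R i) = (\<Sum>j<n-l. ?e i j) + (\<Sum>j=n-l..<n. ?e i j)" for i
    unfolding deg_sum lessThan_atLeast0 using kl by (intro sum.atLeastLessThan_concat[symmetric]) auto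
  have "(\<Sum>j<n-l. ?e i j) \<le> real n - 1 - real l" if "i < k" for i
  proof -
    \<comment> \<open>As i < k \<le> n - l, vertex \<open>i\<close> itself lies in the range and is
      never its own neighbour, which gives the extra - 1.\<close>
    have "(\<Sum>j<n-l. ?e i j) = (\<Sum>j\<in>{..<n-l} - {i}. ?e i j)"
      using assms(2) by (intro sum.mono_neutral_right) (auto simp: irreflp_def)
    also have "\<dots> \<le> (\<Sum>j\<in>{..<n-l} - {i}. 1)" by (intro sum_mono) auto
    finally show ?thesis using that kl by (simp add: of_nat_diff)
  qed
  then have "(\<Sum>i<k. \<Sum>j<n-l. ?e i j) \<le> (\<Sum>i<k. real n - 1 - real l)" by (intro sum_mono) auto
  moreover have "(\<Sum>i<k. \<Sum>j=n-l..<n. ?e i j) \<le> (\<Sum>j=n-l..<n. real (deg n R j))"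
  proof -
    have "(\<Sum>i<k. \<Sum>j=n-l..<n. ?e i j) = (\<Sum>j=n-l..<n. \<Sum>i<k. ?e j i)"
      using assms(1) by (subst sum.swap) (intro sum.cong refl arg_cong[of _ _ of_bool], auto simp: symp_def)
    also have "\<dots> \<le> (\<Sum>j=n-l..<n. real (deg n R j))"
      unfolding deg_sum using kl by (intro sum_mono sum_mono2) auto
    finally show ?thesis .
  qed
  moreover have "(\<Sum>i<k. real (deg n R i)) = (\<Sum>i<k. \<Sum>j<n-l. ?e i j) + (\<Sum>i<k. \<Sum>j=n-l..<n. ?e i j)"
    by (simp only: split sum.distrib)
  moreover have "(\<Sum>i<k. real n - 1 - real l) = real k * (real n - 1 - real l)" by simp
  ultimately show "0 \<le> gap n (\<lambda>i. real (deg n R i)) k l"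
    unfolding gap_def end_diff_def by linarith
qed (use dec in auto)

text \<open>Only the column index is shifted, so this holds for every row; unfolding
  \<open>deg\<close> then matches it with a row of the shifted relation.\<close>

lemma deg_Suc_shift:
  "deg (Suc n) R i = of_bool (R i 0) + deg n (\<lambda>i j. R i (Suc j)) i"
proof -
  have "{j. j < Suc n \<and> R i j} = {j. j = 0 \<and> R i j} \<union> Suc ` {j. j < n \<and> R i (Suc j)}"
    by (auto simp: image_iff less_Suc_eq_0_disj)
  then have "deg (Suc n) R i = card {j. j = 0 \<and> R i j} + card (Suc ` {j. j < n \<and> R i (Suc j)})"
    unfolding deg_def by (simp add: card_Un_disjoint disjoint_iff)
  moreover have "{j. j = 0 \<and> R i j} = (if R i 0 then {0} else {})" by auto
  ultimately show ?thesis by (simp add: deg_def card_image)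
qed

lemma deg_Suc: "deg (Suc n) R i = of_bool (R i n) + deg n R i"
proof -
  have "{j. j < Suc n \<and> R i j} = (if R i n then insert n {j. j < n \<and> R i j} else {j. j < n \<and> R i j})"
    by (auto simp: less_Suc_eq)
  then show ?thesis by (simp add: deg_def)
qed

text \<open>The dominating or isolated vertex may sit anywhere, but the degrees decrease: vertex 0
  is then dominating as well, respectively the last vertex isolated. Removing that vertex keeps the
  order of the remaining degrees.\<close>

lemma threshold_on_threshold_seq:
  assumes "symp R" "irreflp R" "threshold_on {..<n} R"
    and "\<And>i j. i \<le> j \<Longrightarrow> j < n \<Longrightarrow> deg n R j \<le> deg n R i"
  shows "threshold_seq n (\<lambda>i. real (deg n R i))"
  using assms
proof (induction n arbitrary: R)
  case 0
  then show ?case by simp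
next
  case (Suc n)
  have ne: "{..<Suc n} \<noteq> {}" by auto
  have irr: "\<not> R i i" and sym: "R i j \<Longrightarrow> R j i" for i j
    using Suc.prems(1,2) by (auto simp: irreflp_def symp_def)
  show ?case
  proof (rule threshold_onD[OF Suc.prems(3) order_refl ne])
    fix v assume v: "v \<in> {..<Suc n}" "\<forall>w\<in>{..<Suc n} - {v}. R v w"
    have "{j. j < Suc n \<and> R v j} = {..<Suc n} - {v}" using v irr by auto
    then have "deg (Suc n) R v = n" using v by (simp add: deg_def)
    then have ge: "n \<le> deg (Suc n) R 0" using Suc.prems(4)[of 0 v] v by simp
    have sub: "{j. j < Suc n \<and> R 0 j} \<subseteq> Suc ` {..<n}"
      using irr by (auto simp: image_iff less_Suc_eq_0_disj)
    \<comment> \<open>The neighbours of 0 lie in a set of n elements and number at least n, so they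
      fill it.\<close>
    then have eq: "{j. j < Suc n \<and> R 0 j} = Suc ` {..<n}"
      using ge by (intro card_seteq) (auto simp: deg_def card_image)
    then have 0: "R 0 (Suc i)" "R (Suc i) 0" if "i < n" for i using that sym by auto
    have d0: "deg (Suc n) R 0 = n" unfolding deg_def eq by (simp add: card_image)
    let ?R = "\<lambda>i j. R (Suc i) (Suc j)"
    have deg: "deg (Suc n) R (Suc i) = Suc (deg n ?R i)" if "i < n" for i
      using 0[OF that] by (simp add: deg_Suc_shift) (simp add: deg_def)
    have "threshold_seq n (\<lambda>i. real (deg n ?R i))"
    proof (rule Suc.IH)
      show "threshold_on {..<n} ?R"
      proof (rule threshold_on_inj_image)
        show "threshold_on (Suc ` {..<n}) R"
          using Suc.prems(3) by (rule threshold_on_subset) auto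
      qed simp
      fix i j assume "i \<le> j" "j < n"
      then show "deg n ?R j \<le> deg n ?R i"
        using Suc.prems(4)[of "Suc i" "Suc j"] deg[of i] deg[of j] by simp
    qed (use irr sym in \<open>auto simp: symp_def irreflp_def\<close>)
    then have "threshold_seq n (\<lambda>i. real (deg (Suc n) R (Suc i)) - 1)"
      using threshold_seq_cong[of n "\<lambda>i. real (deg (Suc n) R (Suc i)) - 1" "\<lambda>i. real (deg n ?R i)"] deg
      by simp
    then show ?thesis using d0 by simp
  next
    fix v assume v: "v \<in> {..<Suc n}" "\<forall>w\<in>{..<Suc n}. \<not> R v w"
    then have "{j. j < Suc n \<and> R v j} = {}" by auto
    then have "deg (Suc n) R v = 0" by (simp add: deg_def)
    then have dn: "deg (Suc n) R n = 0" using Suc.prems(4)[of v n] v by simp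
    then have "\<forall>j<Suc n. \<not> R n j" by (auto simp: deg_def)
    then have "\<not> R i n" if "i < n" for i using sym[of i n] that by auto
    then have deg: "deg (Suc n) R i = deg n R i" if "i < n" for i using that by (simp add: deg_Suc)
    have "threshold_seq n (\<lambda>i. real (deg n R i))"
    proof (rule Suc.IH)
      show "threshold_on {..<n} R"
        using Suc.prems(3) by (rule threshold_on_subset) auto
      fix i j assume "i \<le> j" "j < n"
      then show "deg n R j \<le> deg n R i"
        using Suc.prems(4)[of i j] deg[of i] deg[of j] by simp
    qed (use Suc.prems in auto)
    then have "threshold_seq n (\<lambda>i. real (deg (Suc n) R i))"
      using threshold_seq_cong[of n "\<lambda>i. real (deg (Suc n) R i)" "\<lambda>i. real (deg n R i)"] deg
      by simp
    then show ?thesis using dn by simp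
  qed
qed

lemma threshold_seq_realizable:
  assumes "threshold_seq n x"
  shows "\<exists>R. symp R \<and> irreflp R \<and> threshold_on {..<n} R \<and> (\<forall>i<n. x i = real (deg n R i))"
  using assms
proof (induction n arbitrary: x)
  case 0
  show ?case
    by (rule exI[of _ "\<lambda>_ _. False"]) (auto simp: symp_def irreflp_def threshold_on_def)
next
  case (Suc n)
  show ?case
  proof (cases "x 0 = real n \<and> threshold_seq n (\<lambda>i. x (Suc i) - 1)")
    case True
    then obtain R where R: "symp R" "irreflp R" "threshold_on {..<n} R"
        "\<And>i. i < n \<Longrightarrow> x (Suc i) - 1 = real (deg n R i)"
      using Suc.IH by blast
    \<comment> \<open>The new dominating vertex becomes 0 and the old vertices move up by 1.\<close>
    define Q where "Q i j = (case i of 0 \<Rightarrow> j \<noteq> 0 | Suc i \<Rightarrow> (case j of 0 \<Rightarrow> True | Suc j \<Rightarrow> R i j))" for i j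
    have Q [simp]: "Q 0 j \<longleftrightarrow> j \<noteq> 0" "Q i 0 \<longleftrightarrow> i \<noteq> 0" "Q (Suc i) (Suc j) = R i j" for i j
      by (auto simp: Q_def split: nat.splits)
    have "symp Q" using R(1) by (auto simp: symp_def Q_def split: nat.splits)
    moreover have "irreflp Q" using R(2) by (auto simp: irreflp_def Q_def split: nat.splits)
    moreover have "threshold_on {..<Suc n} Q"
      unfolding threshold_on_def
    proof (intro allI impI)
      fix S assume S: "S \<subseteq> {..<Suc n}" "S \<noteq> {}"
      show "\<exists>v\<in>S. (\<forall>w\<in>S - {v}. Q v w) \<or> (\<forall>w\<in>S. \<not> Q v w)"
      proof (cases "0 \<in> S")
        case True
        then show ?thesis by (intro bexI[of _ 0]) auto
      next
        case False
        define T where "T = {i. Suc i \<in> S}"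
        have ST: "S = Suc ` T"
        proof
          show "S \<subseteq> Suc ` T"
          proof
            fix s assume "s \<in> S"
            then show "s \<in> Suc ` T" using False by (cases s) (auto simp: T_def)
          qed
        qed (auto simp: T_def)
        have "T \<subseteq> {..<n}" "T \<noteq> {}" using S ST by auto
        then obtain v where "v \<in> T" "(\<forall>w\<in>T - {v}. R v w) \<or> (\<forall>w\<in>T. \<not> R v w)"
          using R(3) unfolding threshold_on_def by metis
        then show ?thesis unfolding ST by (intro bexI[of _ "Suc v"]) auto
      qed
    qed
    moreover have "x i = real (deg (Suc n) Q i)" if "i < Suc n" for i
      using that R(4)[of "i - 1"] True by (cases i) (auto simp: deg_Suc_shift, auto simp: deg_def)
    ultimately show ?thesis by blast
  next
    case False
    then have x: "x n = 0" "threshold_seq n x" using Suc.prems by auto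
    then obtain R where R: "symp R" "irreflp R" "threshold_on {..<n} R"
        "\<And>i. i < n \<Longrightarrow> x i = real (deg n R i)"
      using Suc.IH by blast
    \<comment> \<open>\<open>R\<close> is unconstrained outside \<open>{..<n}\<close>, so it is cut
      down to make \<open>n\<close> isolated.\<close>
    define Q where "Q i j \<longleftrightarrow> R i j \<and> i < n \<and> j < n" for i j
    have "symp Q" "irreflp Q" using R(1,2) by (auto simp: symp_def irreflp_def Q_def)
    moreover have "threshold_on {..<Suc n} Q"
      unfolding threshold_on_def
    proof (intro allI impI)
      fix S assume S: "S \<subseteq> {..<Suc n}" "S \<noteq> {}"
      show "\<exists>v\<in>S. (\<forall>w\<in>S - {v}. Q v w) \<or> (\<forall>w\<in>S. \<not> Q v w)"
      proof (cases "n \<in> S")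
        case True
        then show ?thesis by (intro bexI[of _ n]) (auto simp: Q_def)
      next
        case False
        then have sub: "S \<subseteq> {..<n}" using S by (auto simp: less_Suc_eq)
        then have "\<exists>v\<in>S. (\<forall>w\<in>S - {v}. R v w) \<or> (\<forall>w\<in>S. \<not> R v w)"
          using R(3) S(2) unfolding threshold_on_def by blast
        then show ?thesis using sub unfolding Q_def by blast
      qed
    qed
    moreover have "x i = real (deg (Suc n) Q i)" if "i < Suc n" for i
    proof (cases "i = n")
      case True
      then show ?thesis using x by (simp add: deg_def Q_def)
    next
      case False
      then have "deg (Suc n) Q i = deg n R i"
        unfolding deg_def Q_def using that by (intro arg_cong[of _ _ card]) auto
      then show ?thesis using R(4) that False by simp
    qed
    ultimately show ?thesis by blast
  qed
qed

section \<open>From relations to graphs and their degree partitions\<close>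

lemma out_degree_with_proj: "out_degree (with_proj G) u = card {w. (u, w) \<in> parcs G}"
proof -
  have "{e \<in> parcs G. fst e = u} = Pair u ` {w. (u, w) \<in> parcs G}" by auto
  then show ?thesis by (simp add: out_degree_def out_arcs_def card_image inj_on_def)
qed

lemma threshold_graph_iff:
  "threshold_graph G \<longleftrightarrow> pair_graph G \<and> threshold_on (pverts G) (\<lambda>u v. (u, v) \<in> parcs G)"
proof -
  have "(\<exists>v. dominating_vertex (with_proj G \<restriction> S) v \<or> isolated_vertex (with_proj G \<restriction> S) v) \<longleftrightarrow>
    (\<exists>v\<in>S. (\<forall>w\<in>S - {v}. (v, w) \<in> parcs G) \<or> (\<forall>w\<in>S. (v, w) \<notin> parcs G))" for S
    unfolding dominating_vertex_def isolated_vertex_def arcs_ends_conv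
    by (simp add: image_iff) blast
  then show ?thesis by (simp add: threshold_graph_def threshold_on_def imp_conjL)
qed

lemma simple_graph_symp_irreflp:
  assumes "pair_graph G"
  shows "symp (\<lambda>u v. (u, v) \<in> parcs G)" "irreflp (\<lambda>u v. (u, v) \<in> parcs G)"
proof -
  interpret pair_graph G by fact
  show "symp (\<lambda>u v. (u, v) \<in> parcs G)" "irreflp (\<lambda>u v. (u, v) \<in> parcs G)"
    using pair_sym_arcs by (auto dest: pair_no_loops simp: symp_def irreflp_def symmetric_def sym_def)
qed

text \<open>Sorting the vertices by degree, instead of the degrees alone, yields a relabelling
  \<open>f\<close> under which the degree partition is the degree sequence in vertex order.\<close>

lemma degree_partition_ordering:
  assumes G: "simple_graph_on n G"
  obtains f where "bij_betw f {..<n} {1..n}"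
    "\<And>i. i < n \<Longrightarrow> degree_partition n G ! i = deg n (\<lambda>i j. (f i, f j) \<in> parcs G) i"
    "\<And>i j. i \<le> j \<Longrightarrow> j < n \<Longrightarrow> degree_partition n G ! j \<le> degree_partition n G ! i"
proof -
  interpret pair_graph G using G by (simp add: simple_graph_on_def)
  let ?d = "out_degree (with_proj G)"
  define vs where "vs = rev (sort_key ?d [1..<Suc n])"
  have vs: "length vs = n" "distinct vs" "set vs = {1..n}" by (auto simp: vs_def)
  \<comment> \<open>A sorted list is determined by its multiset, so sorting the degrees agrees with
    reading them off the sorted vertices.\<close>
  have "sort (map ?d [1..<Suc n]) = map ?d (sort_key ?d [1..<Suc n])"
    by (rule properties_for_sort) (simp_all only: mset_map mset_sort sorted_sort_key)
  then have dp: "degree_partition n G = map ?d vs"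
    by (simp add: degree_partition_def vs_def rev_map)
  have bij: "bij_betw ((!) vs) {..<n} {1..n}"
    using bij_betw_nth[of vs "{..<n}" "{1..n}"] vs by simp
  show ?thesis
  proof (rule that[OF bij])
    fix i assume i: "i < n"
    have "{w. (vs ! i, w) \<in> parcs G} = (!) vs ` {j. j < n \<and> (vs ! i, vs ! j) \<in> parcs G}"
    proof (intro equalityI subsetI)
      fix w assume w: "w \<in> {w. (vs ! i, w) \<in> parcs G}"
      then have "w \<in> set vs" using in_arcsD2 G vs(3) by (auto simp: simple_graph_on_def)
      then show "w \<in> (!) vs ` {j. j < n \<and> (vs ! i, vs ! j) \<in> parcs G}"
        using w vs(1) by (auto simp: in_set_conv_nth)
    qed auto
    moreover have "inj_on ((!) vs) {j. j < n \<and> (vs ! i, vs ! j) \<in> parcs G}"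
      using bij by (auto simp: bij_betw_def inj_on_def)
    ultimately show "degree_partition n G ! i = deg n (\<lambda>i j. (vs ! i, vs ! j) \<in> parcs G) i"
      using i vs(1) by (simp add: dp out_degree_with_proj deg_def card_image)
  next
    fix i j assume "i \<le> j" "j < n"
    then show "degree_partition n G ! j \<le> degree_partition n G ! i"
      using sorted_rev_nth_mono[of "degree_partition n G" i j] by (simp add: degree_partition_def)
  qed
qed

lemma degree_partition_feasible:
  assumes G: "simple_graph_on n G"
  shows "feasible n (\<lambda>i. real (degree_partition n G ! i))"
    and "threshold_graph G \<Longrightarrow> threshold_seq n (\<lambda>i. real (degree_partition n G ! i))"
proof -
  obtain f where f: "bij_betw f {..<n} {1..n}"
    and deg: "\<And>i. i < n \<Longrightarrow> degree_partition n G ! i = deg n (\<lambda>i j. (f i, f j) \<in> parcs G) i"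
    and dec: "\<And>i j. i \<le> j \<Longrightarrow> j < n \<Longrightarrow> degree_partition n G ! j \<le> degree_partition n G ! i"
    using degree_partition_ordering[OF G] by metis
  let ?R = "\<lambda>i j. (f i, f j) \<in> parcs G"
  have R: "symp ?R" "irreflp ?R"
    using simple_graph_symp_irreflp[of G] G by (auto simp: simple_graph_on_def symp_def irreflp_def)
  have dec': "deg n ?R j \<le> deg n ?R i" if "i \<le> j" "j < n" for i j
    using dec[OF that] deg that by simp
  show "feasible n (\<lambda>i. real (degree_partition n G ! i))"
    using deg_feasible[OF R, of n] dec'
      feasible_cong[of n "\<lambda>i. real (degree_partition n G ! i)" "\<lambda>i. real (deg n ?R i)"] deg by simp
  assume "threshold_graph G"
  then have "threshold_on (f ` {..<n}) (\<lambda>u v. (u, v) \<in> parcs G)"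
    using G f by (simp add: threshold_graph_iff simple_graph_on_def bij_betw_def)
  then have "threshold_on {..<n} ?R"
    by (rule threshold_on_inj_image[OF bij_betw_imp_inj_on[OF f]])
  then have "threshold_seq n (\<lambda>i. real (deg n ?R i))"
    using threshold_on_threshold_seq[OF R] dec' by blast
  then show "threshold_seq n (\<lambda>i. real (degree_partition n G ! i))"
    using threshold_seq_cong[of n "\<lambda>i. real (degree_partition n G ! i)" "\<lambda>i. real (deg n ?R i)"] deg by simp
qed

lemma threshold_seq_graph:
  assumes x: "threshold_seq n x"
  obtains G where "simple_graph_on n G" "threshold_graph G"
    "\<And>i. i < n \<Longrightarrow> real (degree_partition n G ! i) = x i"
proof -
  obtain R where R: "symp R" "irreflp R" "threshold_on {..<n} R"
    and deg: "\<And>i. i < n \<Longrightarrow> x i = real (deg n R i)"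
    using threshold_seq_realizable[OF x] by blast
  \<comment> \<open>Vertices 0, ..., n - 1 of the relation become 1, ..., n; restricting to indices
    below n keeps all arcs inside the vertex set.\<close>
  define A where "A = {(Suc i, Suc j) | i j. i < n \<and> j < n \<and> R i j}"
  define G where "G = \<lparr>pverts = {1..n}, parcs = A\<rparr>"
  have A: "(u, v) \<in> A \<longleftrightarrow> u \<in> {1..n} \<and> v \<in> {1..n} \<and> R (u - 1) (v - 1)" for u v
    by (cases u; cases v) (auto simp: A_def)
  have "A \<subseteq> {1..n} \<times> {1..n}" using A by auto
  then have fin: "finite A" by (rule finite_subset) simp
  have pg: "pair_graph G"
    using R(1,2) fin unfolding G_def
    by unfold_locales (auto simp: A symmetric_def sym_def symp_def irreflp_def)
  then have G: "simple_graph_on n G" by (simp add: simple_graph_on_def G_def)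
  have "threshold_on ((\<lambda>u. u - 1) ` {1..n}) R"
    using R(3) by (rule back_subst[of "\<lambda>S. threshold_on S R"]) (force simp: image_iff intro: bexI[of _ "Suc _"])
  then have "threshold_on {1..n} (\<lambda>u v. R (u - 1) (v - 1))"
    by (rule threshold_on_inj_image[rotated]) (auto simp: inj_on_def)
  then have "threshold_on {1..n} (\<lambda>u v. (u, v) \<in> A)"
    unfolding threshold_on_def A by (meson DiffD1 subsetD)
  then have T: "threshold_graph G" using pg by (simp add: threshold_graph_iff G_def)
  have out: "out_degree (with_proj G) (Suc i) = deg n R i" if "i < n" for i
  proof -
    have "{w. (Suc i, w) \<in> A} = Suc ` {j. j < n \<and> R i j}" using that by (auto simp: A_def)
    then show ?thesis by (simp add: out_degree_with_proj G_def deg_def card_image)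
  qed
  have "map (out_degree (with_proj G)) [1..<Suc n] = map (deg n R) [0..<n]"
    by (rule nth_equalityI) (auto simp: out simp del: upt_Suc)
  \<comment> \<open>Threshold sequences are feasible, hence already decreasing, so sorting leaves
    the list of degrees unchanged.\<close>
  moreover have "sorted (rev (map (deg n R) [0..<n]))"
    using feasible_antimono[OF threshold_seq_feasible[OF x]] deg
    by (auto simp: sorted_rev_iff_nth_mono)
  ultimately have "degree_partition n G = map (deg n R) [0..<n]"
    using properties_for_sort[of "rev (map (deg n R) [0..<n])" "map (deg n R) [0..<n]"]
    by (simp add: degree_partition_def)
  then have "real (degree_partition n G ! i) = x i" if "i < n" for i using deg that by simp
  then show ?thesis using that G T by blast
qed

section \<open>The polytope\<close>

lemma bij_betw_pos: "bij_betw (pos :: 'n::{finite,linorder} \<Rightarrow> nat) UNIV {1..CARD('n)}"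
proof -
  have less: "pos i < pos j" if "i < j" for i j :: 'n
  proof -
    have "j \<in> {k. k \<le> j}" "j \<notin> {k. k \<le> i}" "{k. k \<le> i} \<subseteq> {k. k \<le> j}" using that by auto
    then have "{k. k \<le> i} \<subset> {k. k \<le> j}" by blast
    then show ?thesis unfolding pos_def by (intro psubset_card_mono) auto
  qed
  then have inj: "inj (pos :: 'n \<Rightarrow> nat)"
    by (metis injI linorder_less_linear order_less_irrefl)
  have "pos i \<in> {1..CARD('n)}" for i :: 'n
  proof -
    have "card {i} \<le> pos i" unfolding pos_def by (intro card_mono) auto
    moreover have "pos i \<le> CARD('n)" unfolding pos_def by (intro card_mono) auto
    ultimately show ?thesis by simp
  qed
  then have "range (pos :: 'n \<Rightarrow> nat) = {1..CARD('n)}"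
    using inj by (intro card_subset_eq) (auto simp: card_image)
  then show ?thesis using inj by (simp add: bij_betw_def)
qed

lemma pos_le_iff: "pos i \<le> pos j \<longleftrightarrow> i \<le> (j :: 'n::{finite,linorder})"
proof -
  have mono: "pos i \<le> pos j" if "i \<le> j" for i j :: 'n
    unfolding pos_def using that by (intro card_mono) auto
  show ?thesis
    using mono bij_betw_pos[where 'n='n] by (metis bij_betw_def inj_eq linorder_linear order_antisym)
qed

text \<open>Converts 0-based positions back to indices; the value is meaningful only for
  \<open>i < CARD('n)\<close>.\<close>

definition index_at :: "nat \<Rightarrow> 'n::{finite,linorder}" where
  "index_at i = inv pos (Suc i)"

lemma pos_index_at: "i < CARD('n) \<Longrightarrow> pos (index_at i :: 'n::{finite,linorder}) = Suc i"
  unfolding index_at_def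
  by (rule f_inv_into_f) (use bij_betw_pos[where 'n='n] in \<open>auto simp: bij_betw_def\<close>)

lemma index_at_pos: "index_at (pos j - Suc 0) = (j :: 'n::{finite,linorder})"
proof -
  have inj: "inj (pos :: 'n \<Rightarrow> nat)" and "pos j \<in> {1..CARD('n)}"
    using bij_betw_pos[where 'n='n] by (auto simp: bij_betw_def)
  then have "Suc (pos j - Suc 0) = pos j" by simp
  then show ?thesis unfolding index_at_def using inv_f_f[OF inj] by metis
qed

lemma pos_less: "pos j - Suc 0 < CARD('n)" for j :: "'n::{finite,linorder}"
proof -
  have "pos j \<in> {1..CARD('n)}" using bij_betw_pos[where 'n='n] by (auto simp: bij_betw_def)
  then show ?thesis by auto
qed

definition seq_of_vec :: "real ^ 'n::{finite,linorder} \<Rightarrow> nat \<Rightarrow> real" where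
  "seq_of_vec x i = x $ index_at i"

definition vec_of_seq :: "(nat \<Rightarrow> real) \<Rightarrow> real ^ 'n::{finite,linorder}" where
  "vec_of_seq f = (\<chi> j. f (pos j - 1))"

lemma seq_of_vec_of_seq:
  "i < CARD('n) \<Longrightarrow> seq_of_vec (vec_of_seq f :: real ^ 'n::{finite,linorder}) i = f i"
  by (simp add: vec_of_seq_def seq_of_vec_def pos_index_at)

lemma vec_eq_seqI:
  fixes x y :: "real ^ 'n::{finite,linorder}"
  assumes "\<And>i. i < CARD('n) \<Longrightarrow> seq_of_vec x i = seq_of_vec y i"
  shows "x = y"
proof -
  have "x $ j = y $ j" for j
    using assms[of "pos j - 1"] pos_less[of j] by (simp add: seq_of_vec_def index_at_pos)
  then show ?thesis by (simp add: vec_eq_iff)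
qed

lemma degree_partition_vec_eq:
  "degree_partition_vec G = (vec_of_seq (\<lambda>i. real (degree_partition CARD('n) G ! i)) :: real ^ 'n::{finite,linorder})"
  by (simp add: degree_partition_vec_def vec_of_seq_def)

lemma sum_pos_interval:
  fixes x :: "real ^ 'n::{finite,linorder}"
  assumes "b \<le> CARD('n)"
  shows "(\<Sum>j | pos j \<in> {a+1..b}. x $ j) = (\<Sum>i=a..<b. seq_of_vec x i)"
proof (rule sum.reindex_bij_witness[of _ index_at "\<lambda>j. pos j - 1"])
  fix i assume "i \<in> {a..<b}"
  then have "pos (index_at i :: 'n) = Suc i" using assms by (intro pos_index_at) auto
  then show "index_at i \<in> {j::'n. pos j \<in> {a+1..b}}" "pos (index_at i :: 'n) - 1 = i"
    using \<open>i \<in> {a..<b}\<close> by auto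
qed (auto simp: index_at_pos seq_of_vec_def)

text \<open>Besides the change of indexing, two differences are bridged: the vacuous pair (0, 0),
  and monotonicity for all pairs of indices versus consecutive positions.\<close>

lemma F_set_iff: "x \<in> F_set \<longleftrightarrow> feasible CARD('n) (seq_of_vec (x :: real ^ 'n::{finite,linorder}))"
proof -
  have "(\<Sum>j | pos j \<in> {1..k}. x $ j) - (\<Sum>j | pos j \<in> {CARD('n) - l + 1..CARD('n)}. x $ j)
      = end_diff CARD('n) (seq_of_vec x) k l" if "k + l \<le> CARD('n)" for k l
    using sum_pos_interval[where x=x and a=0 and b=k] that
      sum_pos_interval[where x=x and a="CARD('n) - l" and b="CARD('n)"]
    by (simp add: end_diff_def lessThan_atLeast0)
  then have sums: "(\<forall>k l. 1 \<le> k + l \<and> k + l \<le> CARD('n) \<longrightarrow>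
      (\<Sum>j | pos j \<in> {1..k}. x $ j) - (\<Sum>j | pos j \<in> {CARD('n) - l + 1..CARD('n)}. x $ j)
        \<le> real k * (real CARD('n) - 1 - real l))
    \<longleftrightarrow> (\<forall>k l. 1 \<le> k + l \<and> k + l \<le> CARD('n) \<longrightarrow> 0 \<le> gap CARD('n) (seq_of_vec x) k l)"
    by (simp add: gap_def)
  have "0 \<le> gap CARD('n) (seq_of_vec x) k l" if "\<not> 1 \<le> k + l" for k l
  proof -
    have "k = 0" "l = 0" using that by auto
    then show ?thesis by simp
  qed
  then have sums': "(\<forall>k l. 1 \<le> k + l \<and> k + l \<le> CARD('n) \<longrightarrow> 0 \<le> gap CARD('n) (seq_of_vec x) k l)
    \<longleftrightarrow> (\<forall>k l. k + l \<le> CARD('n) \<longrightarrow> 0 \<le> gap CARD('n) (seq_of_vec x) k l)"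
    by blast
  have "(\<forall>i j. i \<le> j \<longrightarrow> x $ i \<ge> x $ j) \<longleftrightarrow> (\<forall>i. Suc i < CARD('n) \<longrightarrow> seq_of_vec x (Suc i) \<le> seq_of_vec x i)"
    (is "?L \<longleftrightarrow> ?R")
  proof
    assume L: ?L
    show ?R
    proof (intro allI impI)
      fix i assume i: "Suc i < CARD('n)"
      then have "pos (index_at i :: 'n) \<le> pos (index_at (Suc i) :: 'n)" by (simp add: pos_index_at)
      then show "seq_of_vec x (Suc i) \<le> seq_of_vec x i"
        using L by (simp add: seq_of_vec_def pos_le_iff)
    qed
  next
    assume R: ?R
    have le: "seq_of_vec x j \<le> seq_of_vec x i" if "i \<le> j" "j < CARD('n)" for i j
      using that
    proof (induction rule: dec_induct)
      case (step j)
      then show ?case using R[rule_format, of j] by simp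
    qed simp
    show ?L
    proof (intro allI impI)
      fix i j :: 'n assume "i \<le> j"
      then have "pos i - Suc 0 \<le> pos j - Suc 0" by (simp add: pos_le_iff diff_le_mono)
      from le[OF this pos_less] show "x $ j \<le> x $ i" by (simp add: seq_of_vec_def index_at_pos)
    qed
  qed
  then show ?thesis
    unfolding F_set_def feasible_def mem_Collect_eq sums sums' by (rule conj_cong) (rule refl)
qed

section \<open>Convexity and compactness of \<open>F_set\<close>\<close>

lemma seq_of_vec_linear [simp]:
  "seq_of_vec (x + y) i = seq_of_vec x i + seq_of_vec y i"
  "seq_of_vec (x - y) i = seq_of_vec x i - seq_of_vec y i"
  "seq_of_vec (c *\<^sub>R x) i = c * seq_of_vec x i"
  by (simp_all add: seq_of_vec_def)

text \<open>The slack is affine in the sequence; its constant term is reproduced because the weights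
  sum to 1.\<close>

lemma gap_convex:
  assumes "u + v = 1"
  shows "gap n (\<lambda>i. u * x i + v * y i) k l = u * gap n x k l + v * gap n y k l"
proof -
  have "real k * (real n - 1 - real l) = (u + v) * (real k * (real n - 1 - real l))"
    using assms by simp
  then show ?thesis
    by (simp add: gap_def end_diff_def sum.distrib sum_distrib_left algebra_simps)
qed

lemma convex_F_set: "convex (F_set :: (real ^ 'n::{finite,linorder}) set)"
proof (rule convexI)
  fix x y :: "real ^ 'n::{finite,linorder}" and u v :: real
  assume x: "x \<in> F_set" and y: "y \<in> F_set" and uv: "0 \<le> u" "0 \<le> v" "u + v = 1"
  have "feasible CARD('n) (\<lambda>i. u * seq_of_vec x i + v * seq_of_vec y i)"
  proof (rule feasibleI)
    fix i assume "Suc i < CARD('n)"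
    then show "u * seq_of_vec x (Suc i) + v * seq_of_vec y (Suc i) \<le> u * seq_of_vec x i + v * seq_of_vec y i"
      using x y uv by (intro add_mono mult_left_mono) (auto simp: F_set_iff feasible_def)
  next
    fix k l assume "k + l \<le> CARD('n)"
    then show "0 \<le> gap CARD('n) (\<lambda>i. u * seq_of_vec x i + v * seq_of_vec y i) k l"
      unfolding gap_convex[OF uv(3)] using x y uv by (simp add: F_set_iff feasible_def)
  qed
  moreover have "seq_of_vec (u *\<^sub>R x + v *\<^sub>R y) = (\<lambda>i. u * seq_of_vec x i + v * seq_of_vec y i)"
    by auto
  ultimately show "u *\<^sub>R x + v *\<^sub>R y \<in> F_set" by (simp add: F_set_iff)
qed

text \<open>Weak inequalities between continuous functions make the set closed, and its coordinates
  lie between 0 and n - 1.\<close>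

lemma compact_F_set: "compact (F_set :: (real ^ 'n::{finite,linorder}) set)"
proof -
  have cont: "continuous_on UNIV (\<lambda>x :: real ^ 'n::{finite,linorder}. seq_of_vec x i)" for i
    unfolding seq_of_vec_def by (intro continuous_intros)
  have eq: "F_set = {x :: real ^ 'n::{finite,linorder}. \<forall>i. Suc i < CARD('n) \<longrightarrow> seq_of_vec x (Suc i) \<le> seq_of_vec x i}
     \<inter> {x. \<forall>k l. k + l \<le> CARD('n) \<longrightarrow> 0 \<le> gap CARD('n) (seq_of_vec x) k l}"
    by (auto simp: F_set_iff feasible_def)
  have "closed (F_set :: (real ^ 'n::{finite,linorder}) set)"
    unfolding eq gap_def end_diff_def
    by (intro closed_Int closed_Collect_all closed_Collect_imp open_Collect_const closed_Collect_le
      continuous_intros cont)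
  moreover have "F_set \<subseteq> cbox (\<chi> j. 0) (\<chi> j. real CARD('n) - 1 :: real ^ 'n::{finite,linorder})"
  proof
    fix x :: "real ^ 'n::{finite,linorder}" assume x: "x \<in> F_set"
    have "0 \<le> x $ j \<and> x $ j \<le> real CARD('n) - 1" for j
      using feasible_nonneg[OF _ pos_less, of "seq_of_vec x" j] feasible_le[OF _ pos_less, of "seq_of_vec x" j] x
      by (simp add: F_set_iff seq_of_vec_def index_at_pos)
    then show "x \<in> cbox (\<chi> j. 0) (\<chi> j. real CARD('n) - 1)" by (simp add: mem_box_cart)
  qed
  then have "bounded (F_set :: (real ^ 'n::{finite,linorder}) set)" by (rule bounded_subset[OF bounded_cbox])
  ultimately show ?thesis by (simp add: compact_eq_bounded_closed)
qed

section \<open>Extreme points and the convex hull\<close>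

lemma TP_iff: "x \<in> TP \<longleftrightarrow> threshold_seq CARD('n) (seq_of_vec (x :: real ^ 'n::{finite,linorder}))"
proof
  assume "x \<in> TP"
  then obtain G where G: "simple_graph_on CARD('n) G" "threshold_graph G" "x = degree_partition_vec G"
    by (auto simp: TP_def)
  then show "threshold_seq CARD('n) (seq_of_vec x)"
    using degree_partition_feasible(2)[OF G(1,2)]
      threshold_seq_cong[of "CARD('n)" "seq_of_vec x" "\<lambda>i. real (degree_partition CARD('n) G ! i)"]
    by (simp add: degree_partition_vec_eq seq_of_vec_of_seq)
next
  assume "threshold_seq CARD('n) (seq_of_vec x)"
  then obtain G where G: "simple_graph_on CARD('n) G" "threshold_graph G"
    and "\<And>i. i < CARD('n) \<Longrightarrow> real (degree_partition CARD('n) G ! i) = seq_of_vec x i"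
    by (rule threshold_seq_graph) (rule that)
  then have "x = degree_partition_vec G"
    by (intro vec_eq_seqI) (simp add: degree_partition_vec_eq seq_of_vec_of_seq)
  then show "x \<in> TP" using G by (auto simp: TP_def)
qed

lemma extreme_point_F_set:
  fixes x :: "real ^ 'n::{finite,linorder}"
  shows "x extreme_point_of F_set \<longleftrightarrow> x \<in> TP"
proof
  assume ext: "x extreme_point_of F_set"
  show "x \<in> TP"
    unfolding TP_iff
  proof (rule rigid_threshold_seq)
    show "feasible CARD('n) (seq_of_vec x)"
      using ext by (simp add: extreme_point_of_def F_set_iff)
  next
    fix d i
    assume d: "feasible CARD('n) (\<lambda>i. seq_of_vec x i + d i)" "feasible CARD('n) (\<lambda>i. seq_of_vec x i - d i)"
      and i: "i < CARD('n)"
    define v :: "real ^ 'n::{finite,linorder}" where "v = vec_of_seq d"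
    have v: "seq_of_vec v i = d i" if "i < CARD('n)" for i
      using that by (simp add: v_def seq_of_vec_of_seq)
    have "x + v \<in> F_set" "x - v \<in> F_set"
      using d v feasible_cong[of "CARD('n)" "seq_of_vec (x + v)" "\<lambda>i. seq_of_vec x i + d i"]
        feasible_cong[of "CARD('n)" "seq_of_vec (x - v)" "\<lambda>i. seq_of_vec x i - d i"]
      by (simp_all add: F_set_iff)
    \<comment> \<open>Being the midpoint of two points of \<open>F_set\<close>, an extreme
      \<open>x\<close> forces them to coincide, so \<open>v\<close> vanishes.\<close>
    moreover have "midpoint (x - v) (x + v) = x"
      by (simp add: midpoint_def scaleR_2[symmetric])
    ultimately have "x - v = x + v"
      using ext midpoint_in_open_segment[of "x - v" "x + v"] unfolding extreme_point_of_def by metis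
    then have "2 *\<^sub>R v = 0" by (simp add: scaleR_2 algebra_simps)
    then have "v = 0" by simp
    then show "d i = 0" using v[OF i] by (simp add: seq_of_vec_def)
  qed
next
  assume x: "x \<in> TP"
  show "x extreme_point_of F_set"
    unfolding extreme_point_of_def
  proof (intro conjI ballI notI)
    show "x \<in> F_set" using x threshold_seq_feasible by (auto simp: TP_iff F_set_iff)
  next
    fix a b assume ab: "a \<in> F_set" "b \<in> F_set" "x \<in> open_segment a b"
    then obtain u where u: "a \<noteq> b" "0 < u" "u < 1" "x = (1 - u) *\<^sub>R a + u *\<^sub>R b"
      by (auto simp: in_segment)
    have "seq_of_vec a i = seq_of_vec x i \<and> seq_of_vec b i = seq_of_vec x i" if "i < CARD('n)" for i
    proof (rule threshold_seq_extreme)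
      show "threshold_seq CARD('n) (seq_of_vec x)" using x by (simp add: TP_iff)
      show "feasible CARD('n) (seq_of_vec a)" "feasible CARD('n) (seq_of_vec b)"
        using ab by (simp_all add: F_set_iff)
      show "seq_of_vec x i = (1 - u) * seq_of_vec a i + u * seq_of_vec b i" for i
        using u(4) by simp
    qed (use u that in auto)
    then have "a = b" by (intro vec_eq_seqI) simp
    then show False using u by simp
  qed
qed

theorem theorem1p3:
  shows "(DP :: (real ^ 'n::{finite,linorder}) set) = F_set \<and>
         {x. x extreme_point_of (DP :: (real ^ 'n::{finite,linorder}) set)} = TP"
proof -
  have "degree_partition_vec G \<in> (F_set :: (real ^ 'n::{finite,linorder}) set)" if "simple_graph_on CARD('n) G" for G
    using degree_partition_feasible(1)[OF that]
      feasible_cong[of "CARD('n)" "seq_of_vec (degree_partition_vec G :: real ^ 'n::{finite,linorder})"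
        "\<lambda>i. real (degree_partition CARD('n) G ! i)"]
    by (simp add: F_set_iff degree_partition_vec_eq seq_of_vec_of_seq)
  then have "(DP :: (real ^ 'n::{finite,linorder}) set) \<subseteq> F_set"
    unfolding DP_def by (intro hull_minimal convex_F_set) auto
  moreover have "F_set \<subseteq> (DP :: (real ^ 'n::{finite,linorder}) set)"
  proof -
    \<comment> \<open>A compact convex set is the hull of its extreme points, here the threshold
      partitions, which are among the generators of \<open>DP\<close>.\<close>
    have "F_set = convex hull (TP :: (real ^ 'n::{finite,linorder}) set)"
      using Krein_Milman_Minkowski[OF compact_F_set convex_F_set] by (simp add: extreme_point_F_set)
    also have "\<dots> \<subseteq> DP"
      unfolding DP_def by (intro hull_mono) (auto simp: TP_def)
    finally show ?thesis .
  qed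
  ultimately have "(DP :: (real ^ 'n::{finite,linorder}) set) = F_set" by blast
  then show ?thesis by (simp add: extreme_point_F_set)
qed

end
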